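(* Let $\phi(\alpha)=\alpha^2-\alpha^3$ for $\alpha\in\mathbb{R}$. The maximum value of $\phi(\alpha)$ on $[0,1]$ is attained at $\alpha=\frac23$. *)

theory Defs
  imports Complex_Main
begin

definition phi :: "real \<Rightarrow> real" where
  "phi \<alpha> = \<alpha>^2 - \<alpha>^3"

end

theory Submission
  imports Defs
begin

text \<open>Since 2/3 is a critical point of \<open>phi\<close>, the cubic
  \<open>phi (2/3) - phi \<alpha>\<close> has a double root there. The remaining factor
  \<open>\<alpha> + 1/3\<close> is positive on [0,1], so the factorisation
  \<open>phi_deficit\<close> gives the bound without derivatives.\<close>

lemma phi_deficit: "phi (2/3) - phi \<alpha> = (\<alpha> - 2/3)\<^sup>2 * (\<alpha> + 1/3)"
  by (simp add: phi_def power2_eq_square power3_eq_cube field_simps)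

theorem proposition1:
  shows "is_arg_max phi (\<lambda>\<alpha>. \<alpha> \<in> {0..1}) (2/3)"
proof -
  have "phi \<alpha> \<le> phi (2/3)" if "\<alpha> \<in> {0..1}" for \<alpha>
  proof -
    have "0 \<le> (\<alpha> - 2/3)\<^sup>2 * (\<alpha> + 1/3)"
      using that by simp
    then show ?thesis
      using phi_deficit[of \<alpha>] by linarith
  qed
  then show ?thesis
    \<comment> \<open>\<open>is_arg_max\<close> asks that no admissible point has a strictly larger
      value; \<open>not_less\<close> turns this into the bound just shown.\<close>
    by (auto simp: is_arg_max_def not_less)
qed

end
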